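(* Let $n\ge 1$. The group $\mathcal{L}_-(\mathrm{GL}(n,\mathbb{C}),\mathbb{C}^n)$ of negative rational loops is generated (as a group under pointwise multiplication) by the following elements: (1) $p_{\alpha,\beta,V,W}(\lambda)=\left(\frac{\lambda-\alpha}{\lambda-\beta}\right)\pi_V+\pi_W$, where $\alpha,\beta\in\mathbb{C}$ are distinct, $\mathbb{C}^n=V\oplus W$ is a decomposition into complex subspaces, and $\pi_V,\pi_W$ are the projections onto $V$ and $W$ along this decomposition; (2) $m_{\alpha,k,N}(\lambda)=\mathrm{Id}+\left(\frac{1}{\lambda-\alpha}\right)^kN$, where $\alpha\in\mathbb{C}$, $k$ is a positive integer, and $N:\mathbb{C}^n\to\mathbb{C}^n$ is a linear map with $N^2=0$.
   Context: A rational loop in $\mathrm{GL}(n,\mathbb{C})$ (with respect to the standard representation on $\mathbb{C}^n$) is a meromorphic map $g:\mathbb{CP}^1\to \mathrm{GL}(n,\mathbb{C})$, i.e. $g$ is an $n\times n$ matrix of rational functions of $\lambda$ that takes values in $\mathrm{GL}(n,\mathbb{C})$ away from finitely many points (equivalently, whose determinant is not identically zero). These form a group $\mathcal{L}(\mathrm{GL}(n,\mathbb{C}),\mathbb{C}^n)$ under pointwise multiplication. A loop $g$ is called negative if it is normalized at infinity: $g(\infty)=\mathrm{Id}$ (in particular $g$ is regular at $\infty$). $\mathcal{L}_-(\mathrm{GL}(n,\mathbb{C}),\mathbb{C}^n)$ denotes the subgroup of negative loops. *)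

theory Defs
  imports
    "HOL-Analysis.Analysis"
    "HOL-Algebra.Generated_Groups"
    "HOL-Computational_Algebra.Polynomial_Factorial"
begin

section \<open>Rational functions of one complex variable\<close>

type_synonym ratfun = "complex poly fract"

definition ratfun_const :: "complex \<Rightarrow> ratfun" where
  "ratfun_const c = to_fract [:c:]"

definition ratfun_var :: ratfun where
  "ratfun_var = to_fract [:0, 1:]"

text \<open>
  \<open>has_value_at f a v\<close>: the rational function \<open>f\<close> has no pole at \<open>a\<close>, and \<open>v\<close> is its value there.
  The fraction \<open>p / q\<close> need not be in lowest terms; any representative whose denominator does not
  vanish at \<open>a\<close> yields the same value.
\<close>
definition has_value_at :: "ratfun \<Rightarrow> complex \<Rightarrow> complex \<Rightarrow> bool" where
  "has_value_at f a v \<longleftrightarrow>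
     (\<exists>p q. f = to_fract p / to_fract q \<and> poly q a \<noteq> 0 \<and> v = poly p a / poly q a)"

text \<open>
  The same at the point at infinity: \<open>p / q\<close> is regular there iff \<open>degree p \<le> degree q\<close>. Its value is
  the quotient of the coefficients in degree \<open>degree q\<close>, so it is \<open>0\<close> when \<open>degree p < degree q\<close>.
\<close>
definition has_value_at_inf :: "ratfun \<Rightarrow> complex \<Rightarrow> bool" where
  "has_value_at_inf f v \<longleftrightarrow>
     (\<exists>p q. f = to_fract p / to_fract q \<and> q \<noteq> 0 \<and> degree p \<le> degree q \<and>
            v = coeff p (degree q) / lead_coeff q)"


section \<open>Rational loops\<close>

text \<open>
  A rational loop is a matrix of rational functions that takes values in the invertible complex
  matrices at all but finitely many points.
\<close>
definition rational_loops :: "(ratfun ^ 'n ^ 'n) set" where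
  "rational_loops =
     {g. finite {a. \<not> (\<exists>A :: complex ^ 'n ^ 'n.
            invertible A \<and> (\<forall>i j. has_value_at (g $ i $ j) a (A $ i $ j)))}}"

definition rational_loop_group :: "(ratfun ^ 'n ^ 'n) monoid" where
  "rational_loop_group = \<lparr>carrier = rational_loops, mult = (**), one = mat 1\<rparr>"

definition negative_loops :: "(ratfun ^ 'n ^ 'n) set" where
  "negative_loops =
     {g \<in> rational_loops. \<forall>i j. has_value_at_inf (g $ i $ j) ((mat 1 :: complex ^ 'n ^ 'n) $ i $ j)}"

definition negative_loop_group :: "(ratfun ^ 'n ^ 'n) monoid" where
  "negative_loop_group = rational_loop_group\<lparr>carrier := negative_loops\<rparr>"


section \<open>The generators\<close>

definition is_direct_sum :: "(complex ^ 'n) set \<Rightarrow> (complex ^ 'n) set \<Rightarrow> bool" where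
  "is_direct_sum V W \<longleftrightarrow>
     vec.subspace V \<and> vec.subspace W \<and> V \<inter> W = {0} \<and> {v + w |v w. v \<in> V \<and> w \<in> W} = UNIV"

text \<open>The matrix of the projection onto \<open>V\<close> along \<open>W\<close>; only meaningful if \<open>is_direct_sum V W\<close>.\<close>
definition proj_along :: "(complex ^ 'n) set \<Rightarrow> (complex ^ 'n) set \<Rightarrow> complex ^ 'n ^ 'n" where
  "proj_along V W = matrix (\<lambda>x. THE v. v \<in> V \<and> (\<exists>w\<in>W. x = v + w))"

definition p_loop ::
  "complex \<Rightarrow> complex \<Rightarrow> (complex ^ 'n) set \<Rightarrow> (complex ^ 'n) set \<Rightarrow> ratfun ^ 'n ^ 'n" where
  "p_loop \<alpha> \<beta> V W =
     (\<chi> i j. (ratfun_var - ratfun_const \<alpha>) / (ratfun_var - ratfun_const \<beta>)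
               * ratfun_const (proj_along V W $ i $ j)
             + ratfun_const (proj_along W V $ i $ j))"

definition m_loop :: "complex \<Rightarrow> nat \<Rightarrow> complex ^ 'n ^ 'n \<Rightarrow> ratfun ^ 'n ^ 'n" where
  "m_loop \<alpha> k N =
     mat 1 + (\<chi> i j. (1 / (ratfun_var - ratfun_const \<alpha>)) ^ k * ratfun_const (N $ i $ j))"

definition p_loops :: "(ratfun ^ 'n ^ 'n) set" where
  "p_loops = {p_loop \<alpha> \<beta> V W |\<alpha> \<beta> V W. \<alpha> \<noteq> \<beta> \<and> is_direct_sum V W}"

definition m_loops :: "(ratfun ^ 'n ^ 'n) set" where
  "m_loops = {m_loop \<alpha> k N |\<alpha> k N. k > 0 \<and> N ** N = 0}"


section \<open>Consistency of the definitions\<close>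

text \<open>The values of a rational function, at a finite point or at infinity, form a partial ring
  homomorphism to the complex numbers.\<close>
locale partial_hom =
  fixes R :: "ratfun \<Rightarrow> complex \<Rightarrow> bool"
  assumes R_const: "R (ratfun_const c) c"
    and R_add: "R f v \<Longrightarrow> R g w \<Longrightarrow> R (f + g) (v + w)"
    and R_mult: "R f v \<Longrightarrow> R g w \<Longrightarrow> R (f * g) (v * w)"
    and R_inverse: "R f v \<Longrightarrow> v \<noteq> 0 \<Longrightarrow> R (inverse f) (inverse v)"
    and R_unique: "R f v \<Longrightarrow> R f w \<Longrightarrow> v = w"
begin

lemma R_0: "R 0 0" and R_1: "R 1 1"
  using R_const[of 0] R_const[of 1] by (simp_all add: ratfun_const_def flip: one_pCons)

lemma R_of_int: "R (of_int k) (of_int k)"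
proof -
  have m1: "R (-1) (-1)"
    using R_const[of "-1"] by (simp add: ratfun_const_def one_pCons flip: to_fract_uminus to_fract_1)
  have n: "R (of_nat n) (of_nat n)" for n
    by (induction n) (use R_0 R_1 R_add in auto)
  show ?thesis
  proof (cases "k \<ge> 0")
    case True
    then show ?thesis using n[of "nat k"] by simp
  next
    case False
    then show ?thesis using R_mult[OF m1 n[of "nat (- k)"]] by simp
  qed
qed

lemma R_sum: "(\<And>x. x \<in> S \<Longrightarrow> R (f x) (v x)) \<Longrightarrow> R (sum f S) (sum v S)"
  by (induction S rule: infinite_finite_induct) (auto intro: R_0 R_add)

lemma R_prod: "(\<And>x. x \<in> S \<Longrightarrow> R (f x) (v x)) \<Longrightarrow> R (prod f S) (prod v S)"
  by (induction S rule: infinite_finite_induct) (auto intro: R_1 R_mult)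

lemma R_det:
  fixes g :: "ratfun ^ 'n ^ 'n" and A :: "complex ^ 'n ^ 'n"
  assumes "\<And>i j. R (g $ i $ j) (A $ i $ j)"
  shows "R (det g) (det A)"
  unfolding det_def by (intro R_sum R_mult R_prod R_of_int assms)

lemma R_matrix_mult:
  fixes g h :: "ratfun ^ 'n ^ 'n" and A B :: "complex ^ 'n ^ 'n"
  assumes "\<And>i j. R (g $ i $ j) (A $ i $ j)" "\<And>i j. R (h $ i $ j) (B $ i $ j)"
  shows "R ((g ** h) $ i $ j) ((A ** B) $ i $ j)"
  unfolding matrix_matrix_mult_def by (simp, intro R_sum R_mult assms)

lemma R_mat_1: "R ((mat 1 :: ratfun ^ 'n ^ 'n) $ i $ j) ((mat 1 :: complex ^ 'n ^ 'n) $ i $ j)"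
  by (simp add: mat_def R_0 R_1)

lemma R_matrix_inv:
  fixes g h :: "ratfun ^ 'n ^ 'n" and A :: "complex ^ 'n ^ 'n"
  assumes "\<And>i j. R (g $ i $ j) (A $ i $ j)" "det A \<noteq> 0" "g ** h = mat 1"
  shows "\<exists>v. R (h $ k $ l) v"
proof -
  have dg: "det g \<noteq> 0"
  proof
    assume "det g = 0"
    then have "R 0 (det A)" using R_det[of g A, OF assms(1)] by simp
    then show False using R_unique[OF R_0] assms(2) by auto
  qed
  let ?e = "column l (mat 1) :: ratfun ^ 'n"
  let ?e' = "column l (mat 1) :: complex ^ 'n"
  have "(g *v column l h) $ i = (g ** h) $ i $ l" for i
    by (simp add: matrix_vector_mult_def matrix_matrix_mult_def column_def)
  then have "g *v column l h = ?e"
    by (simp add: assms(3) vec_eq_iff column_def)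
  then have "column l h = (\<chi> k. det (\<chi> i j. if j = k then ?e $ i else g $ i $ j) / det g)"
    using cramer[OF dg, of "column l h" ?e] by simp
  then have "column l h $ k = (\<chi> k. det (\<chi> i j. if j = k then ?e $ i else g $ i $ j) / det g) $ k"
    by (rule arg_cong)
  then have hkl: "h $ k $ l = det (\<chi> i j. if j = k then ?e $ i else g $ i $ j) * inverse (det g)"
    by (simp add: column_def divide_inverse)
  have "R (det (\<chi> i j. if j = k then ?e $ i else g $ i $ j))
      (det (\<chi> i j. if j = k then ?e' $ i else A $ i $ j))"
    by (rule R_det) (simp add: assms(1) column_def R_mat_1)
  from R_mult[OF this R_inverse[OF R_det[of g A, OF assms(1)] assms(2)]]
  show ?thesis unfolding hkl by blast
qed

end

lemma partial_hom_at: "partial_hom (\<lambda>f. has_value_at f a)"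
proof
  show "has_value_at (ratfun_const c) a c" for c
    unfolding has_value_at_def ratfun_const_def
    by (intro exI[of _ "[:c:]"] exI[of _ 1]) simp
next
  fix f v g w assume "has_value_at f a v" "has_value_at g a w"
  then obtain p q p' q' where *: "f = to_fract p / to_fract q" "poly q a \<noteq> 0" "v = poly p a / poly q a"
      "g = to_fract p' / to_fract q'" "poly q' a \<noteq> 0" "w = poly p' a / poly q' a"
    unfolding has_value_at_def by blast
  have nz: "q \<noteq> 0" "q' \<noteq> 0" using * by auto
  have "f + g = to_fract (p * q' + p' * q) / to_fract (q * q')"
    using *(1,4) nz by (simp add: add_frac_eq)
  moreover have "v + w = poly (p * q' + p' * q) a / poly (q * q') a"
    using *(2,3,5,6) by (simp add: add_frac_eq)
  moreover have "poly (q * q') a \<noteq> 0" using *(2,5) by simp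
  ultimately show "has_value_at (f + g) a (v + w)" unfolding has_value_at_def by blast
  have "f * g = to_fract (p * p') / to_fract (q * q')" using *(1,4) by simp
  moreover have "v * w = poly (p * p') a / poly (q * q') a" using *(3,6) by simp
  moreover have "poly (q * q') a \<noteq> 0" using *(2,5) by simp
  ultimately show "has_value_at (f * g) a (v * w)" unfolding has_value_at_def by blast
next
  fix f v assume "has_value_at f a v" "v \<noteq> 0"
  then obtain p q where *: "f = to_fract p / to_fract q" "poly q a \<noteq> 0" "v = poly p a / poly q a"
    unfolding has_value_at_def by blast
  then show "has_value_at (inverse f) a (inverse v)" unfolding has_value_at_def
    using \<open>v \<noteq> 0\<close> by (intro exI[of _ q] exI[of _ p]) (auto simp: field_simps)
next
  fix f v w assume "has_value_at f a v" "has_value_at f a w"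
  then obtain p q p' q' where *: "f = to_fract p / to_fract q" "poly q a \<noteq> 0" "v = poly p a / poly q a"
      "f = to_fract p' / to_fract q'" "poly q' a \<noteq> 0" "w = poly p' a / poly q' a"
    unfolding has_value_at_def by blast
  have nz: "q \<noteq> 0" "q' \<noteq> 0" using * by auto
  have "to_fract (p * q') = to_fract (p' * q)" using * nz by (simp add: field_simps)
  then have "p * q' = p' * q" by (simp only: to_fract_eq_iff)
  then have "poly p a * poly q' a = poly p' a * poly q a" by (metis poly_mult)
  then show "v = w" using *(2,5) unfolding *(3,6) by (simp add: frac_eq_eq)
qed

lemma coeff_mult_le_degree:
  fixes p q :: "complex poly"
  assumes "degree p \<le> m" "degree q \<le> n"
  shows "coeff (p * q) (m + n) = coeff p m * coeff q n"
proof (cases "degree p = m \<and> degree q = n")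
  case True
  then show ?thesis using coeff_mult_degree_sum[of p q] by simp
next
  case False
  then have "degree p + degree q < m + n" using assms by linarith
  then have "coeff (p * q) (m + n) = 0"
    using degree_mult_le[of p q] by (intro coeff_eq_0) linarith
  moreover have "coeff p m = 0 \<or> coeff q n = 0"
    using False assms by (metis coeff_eq_0 le_neq_implies_less)
  ultimately show ?thesis by auto
qed

lemma partial_hom_at_inf: "partial_hom has_value_at_inf"
proof
  show "has_value_at_inf (ratfun_const c) c" for c
    unfolding has_value_at_inf_def ratfun_const_def
    by (intro exI[of _ "[:c:]"] exI[of _ 1]) simp
next
  fix f v g w assume "has_value_at_inf f v" "has_value_at_inf g w"
  then obtain p q p' q' where *: "f = to_fract p / to_fract q" "degree p \<le> degree q"
      "v = coeff p (degree q) / lead_coeff q"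
      "g = to_fract p' / to_fract q'" "degree p' \<le> degree q'"
      "w = coeff p' (degree q') / lead_coeff q'" and nz: "q \<noteq> 0" "q' \<noteq> 0"
    unfolding has_value_at_inf_def by blast
  have d: "degree (q * q') = degree q + degree q'" using nz by (simp add: degree_mult_eq)
  have c1: "coeff (p * q') (degree q + degree q') = coeff p (degree q) * lead_coeff q'"
    using * by (simp add: coeff_mult_le_degree)
  have c2: "coeff (p' * q) (degree q + degree q') = coeff p' (degree q') * lead_coeff q"
    using * coeff_mult_le_degree[of p' "degree q'" q "degree q"] by (simp add: add.commute)
  have c3: "coeff (p * p') (degree q + degree q') = coeff p (degree q) * coeff p' (degree q')"
    using * by (simp add: coeff_mult_le_degree)
  have l: "lead_coeff q \<noteq> 0" "lead_coeff q' \<noteq> 0" using nz by simp_all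
  have d1: "degree (p * q' + p' * q) \<le> degree q + degree q'"
    using *(2,5) degree_mult_le[of p q'] degree_mult_le[of p' q] by (intro degree_add_le) linarith+
  have d2: "degree (p * p') \<le> degree q + degree q'"
    using *(2,5) degree_mult_le[of p p'] by linarith
  have e1: "f + g = to_fract (p * q' + p' * q) / to_fract (q * q')"
    using *(1,4) nz by (simp add: add_frac_eq)
  have v1: "v + w = coeff (p * q' + p' * q) (degree (q * q')) / lead_coeff (q * q')"
    unfolding lead_coeff_mult unfolding coeff_add d c1 c2 *(3,6) using l by (simp add: add_frac_eq)
  show "has_value_at_inf (f + g) (v + w)" unfolding has_value_at_inf_def
    using e1 v1 d1 nz d by (metis mult_eq_0_iff)
  have e2: "f * g = to_fract (p * p') / to_fract (q * q')"
    using *(1,4) by simp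
  have v2: "v * w = coeff (p * p') (degree (q * q')) / lead_coeff (q * q')"
    unfolding lead_coeff_mult unfolding d c3 *(3,6) by simp
  show "has_value_at_inf (f * g) (v * w)" unfolding has_value_at_inf_def
    using e2 v2 d2 nz d by (metis mult_eq_0_iff)
next
  fix f v assume "has_value_at_inf f v" "v \<noteq> 0"
  then obtain p q where *: "f = to_fract p / to_fract q" "q \<noteq> 0" "degree p \<le> degree q"
      "v = coeff p (degree q) / lead_coeff q"
    unfolding has_value_at_inf_def by blast
  have "coeff p (degree q) \<noteq> 0" using * \<open>v \<noteq> 0\<close> by auto
  then have "degree p = degree q" "p \<noteq> 0" using *(3) le_degree[of p "degree q"] by auto
  then show "has_value_at_inf (inverse f) (inverse v)" unfolding has_value_at_inf_def
    using * by (intro exI[of _ q] exI[of _ p]) simp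
next
  fix f v w assume "has_value_at_inf f v" "has_value_at_inf f w"
  then obtain p q p' q' where *: "f = to_fract p / to_fract q" "degree p \<le> degree q"
      "v = coeff p (degree q) / lead_coeff q"
      "f = to_fract p' / to_fract q'" "degree p' \<le> degree q'"
      "w = coeff p' (degree q') / lead_coeff q'" and nz: "q \<noteq> 0" "q' \<noteq> 0"
    unfolding has_value_at_inf_def by blast
  have "to_fract (p * q') = to_fract (p' * q)" using * nz by (simp add: field_simps)
  then have eq: "p * q' = p' * q" by (simp only: to_fract_eq_iff)
  have "coeff p (degree q) * lead_coeff q' = coeff p' (degree q') * lead_coeff q"
    using * eq coeff_mult_le_degree[of p "degree q" q' "degree q'"]
      coeff_mult_le_degree[of p' "degree q'" q "degree q"] by (simp add: add.commute)
  then show "v = w" using nz unfolding *(3,6) by (simp add: frac_eq_eq)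
qed

lemma ex_value_at_cofinite: "finite {a. \<not> (\<exists>v. has_value_at f a v)}"
proof -
  obtain p q where *: "f = to_fract p / to_fract q" "q \<noteq> 0"
    by (cases f rule: Fract_cases) (auto simp: Fract_conv_to_fract)
  have "{a. \<not> (\<exists>v. has_value_at f a v)} \<subseteq> {a. poly q a = 0}"
    unfolding has_value_at_def using * by blast
  then show ?thesis using poly_roots_finite[OF *(2)] by (rule finite_subset)
qed

lemma rational_loops_iff_det: "g \<in> rational_loops \<longleftrightarrow> det g \<noteq> 0"
  for g :: "ratfun ^ 'n ^ 'n"
proof
  assume "g \<in> rational_loops"
  then have "{a. \<not> (\<exists>A :: complex ^ 'n ^ 'n.
      invertible A \<and> (\<forall>i j. has_value_at (g $ i $ j) a (A $ i $ j)))} \<noteq> UNIV"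
    unfolding rational_loops_def using infinite_UNIV_char_0[where 'a = complex] by force
  then obtain a and A :: "complex ^ 'n ^ 'n"
    where A: "invertible A" "\<And>i j. has_value_at (g $ i $ j) a (A $ i $ j)" by blast
  interpret partial_hom "\<lambda>f. has_value_at f a" by (rule partial_hom_at)
  show "det g \<noteq> 0" using R_det[OF A(2)] R_0 R_unique A(1) invertible_det_nz by metis
next
  assume nz: "det g \<noteq> 0"
  let ?B = "(\<Union>i. \<Union>j. {a. \<not> (\<exists>v. has_value_at (g $ i $ j) a v)})
             \<union> {a. \<not> (\<exists>v. has_value_at (inverse (det g)) a v)}"
  have "{a. \<not> (\<exists>A :: complex ^ 'n ^ 'n. invertible A \<and> (\<forall>i j. has_value_at (g $ i $ j) a (A $ i $ j)))} \<subseteq> ?B"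
  proof (intro subsetI, rule ccontr)
    fix a
    assume a: "a \<in> {a. \<not> (\<exists>A :: complex ^ 'n ^ 'n. invertible A \<and> (\<forall>i j. has_value_at (g $ i $ j) a (A $ i $ j)))}"
      and "a \<notin> ?B"
    then have "\<forall>i j. \<exists>v. has_value_at (g $ i $ j) a v" and "\<exists>v. has_value_at (inverse (det g)) a v"
      by auto
    then obtain V v where V: "\<And>i j. has_value_at (g $ i $ j) a (V i j)"
        and v: "has_value_at (inverse (det g)) a v" by metis
    define A :: "complex ^ 'n ^ 'n" where "A = (\<chi> i j. V i j)"
    have A: "has_value_at (g $ i $ j) a (A $ i $ j)" for i j by (simp add: A_def V)
    interpret partial_hom "\<lambda>f. has_value_at f a" by (rule partial_hom_at)
    have "has_value_at 1 a (det A * v)" using R_mult[OF R_det[OF A] v] nz by simp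
    then have "det A * v = 1" using R_1 R_unique by blast
    then have "invertible A" by (auto simp: invertible_det_nz)
    then show False using a A by blast
  qed
  moreover have "finite ?B" by (intro finite_UnI finite_UN_I finite ex_value_at_cofinite)
  ultimately show "g \<in> rational_loops" unfolding rational_loops_def by (simp add: finite_subset)
qed

lemma group_rational_loop_group: "group (rational_loop_group :: (ratfun ^ 'n ^ 'n) monoid)"
proof (rule groupI)
  fix g :: "ratfun ^ 'n ^ 'n" assume "g \<in> carrier rational_loop_group"
  then have "invertible g" by (simp add: rational_loop_group_def rational_loops_iff_det invertible_det_nz)
  then obtain h where "g ** h = mat 1" "h ** g = mat 1" by (auto simp: invertible_def)
  then show "\<exists>h\<in>carrier rational_loop_group. h \<otimes>\<^bsub>rational_loop_group\<^esub> g = \<one>\<^bsub>rational_loop_group\<^esub>"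
    by (auto simp: rational_loop_group_def rational_loops_iff_det invertible_def
        simp flip: invertible_det_nz intro!: bexI[of _ h])
qed (auto simp: rational_loop_group_def rational_loops_iff_det det_mul matrix_mul_assoc)

lemma subgroup_negative_loops:
  "subgroup negative_loops (rational_loop_group :: (ratfun ^ 'n ^ 'n) monoid)"
proof -
  interpret G: group "rational_loop_group :: (ratfun ^ 'n ^ 'n) monoid"
    by (rule group_rational_loop_group)
  interpret partial_hom has_value_at_inf by (rule partial_hom_at_inf)
  show ?thesis
  proof (rule G.subgroupI)
    show "negative_loops \<subseteq> carrier (rational_loop_group :: (ratfun ^ 'n ^ 'n) monoid)"
      by (auto simp: negative_loops_def rational_loop_group_def)
    have "mat 1 \<in> (negative_loops :: (ratfun ^ 'n ^ 'n) set)"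
      unfolding negative_loops_def by (simp add: rational_loops_iff_det R_mat_1)
    then show "(negative_loops :: (ratfun ^ 'n ^ 'n) set) \<noteq> {}" by blast
  next
    fix g :: "ratfun ^ 'n ^ 'n" assume g: "g \<in> negative_loops"
    then have gc: "g \<in> carrier rational_loop_group"
      by (auto simp: negative_loops_def rational_loop_group_def)
    define h where "h = inv\<^bsub>rational_loop_group\<^esub> g"
    have hc: "h \<in> carrier rational_loop_group" using gc by (simp add: h_def)
    have gh: "g ** h = mat 1"
      using G.r_inv[OF gc] by (simp add: h_def rational_loop_group_def)
    have gR: "\<And>i j. has_value_at_inf (g $ i $ j) ((mat 1 :: complex ^ 'n ^ 'n) $ i $ j)"
      using g by (simp add: negative_loops_def)
    have "\<forall>i j. \<exists>v. has_value_at_inf (h $ i $ j) v"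
      using R_matrix_inv[OF gR _ gh] by simp
    then obtain V where V: "\<And>i j. has_value_at_inf (h $ i $ j) (V i j)" by metis
    define A :: "complex ^ 'n ^ 'n" where "A = (\<chi> i j. V i j)"
    have hR: "has_value_at_inf (h $ i $ j) (A $ i $ j)" for i j by (simp add: A_def V)
    have "has_value_at_inf ((mat 1 :: ratfun ^ 'n ^ 'n) $ i $ j) (A $ i $ j)" for i j
      using R_matrix_mult[OF gR hR, of i j] by (simp add: gh)
    then have "A = mat 1" using R_mat_1 R_unique by (metis vec_eq_iff)
    then have "h \<in> negative_loops"
      using hR hc by (simp add: negative_loops_def rational_loop_group_def)
    then show "inv\<^bsub>rational_loop_group\<^esub> g \<in> negative_loops" by (simp add: h_def)
  next
    fix g h :: "ratfun ^ 'n ^ 'n" assume gh: "g \<in> negative_loops" "h \<in> negative_loops"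
    have "has_value_at_inf ((g ** h) $ i $ j) ((mat 1 ** mat 1 :: complex ^ 'n ^ 'n) $ i $ j)" for i j
      by (rule R_matrix_mult) (use gh in \<open>auto simp: negative_loops_def\<close>)
    moreover have "g ** h \<in> rational_loops"
      using gh by (simp add: negative_loops_def rational_loops_iff_det det_mul)
    ultimately show "g \<otimes>\<^bsub>rational_loop_group\<^esub> h \<in> negative_loops"
      by (simp add: negative_loops_def rational_loop_group_def)
  qed
qed

lemma group_negative_loop_group: "group (negative_loop_group :: (ratfun ^ 'n ^ 'n) monoid)"
  unfolding negative_loop_group_def
  by (rule subgroup.subgroup_is_group[OF subgroup_negative_loops group_rational_loop_group])

end

theory Submission
  imports Defs "HOL-Computational_Algebra.Fundamental_Theorem_Algebra"
begin

text \<open>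
  The rational functions regular at infinity form a local ring, and a negative loop is congruent to
  the identity modulo its maximal ideal. Its diagonal entries are therefore units and Gauss--Jordan
  elimination needs no pivoting: a negative loop is a product of negative loops that differ from the
  identity in a single column. Such a column matrix is a product of a diagonal matrix with one
  nontrivial entry \<open>u\<close>, where \<open>u = 1\<close> at infinity, and of transvections with an entry \<open>f\<close>, where
  \<open>f = 0\<close> at infinity. Factoring \<open>u\<close> into quotients of linear polynomials yields loops of the first
  kind, and decomposing \<open>f\<close> into partial fractions yields loops of the second kind.
\<close>

interpretation at_inf: partial_hom has_value_at_inf
  by (rule partial_hom_at_inf)

section \<open>Values at infinity\<close>

lemma has_value_at_inf_to_fract_divide:
  assumes "q \<noteq> 0" "degree p \<le> degree q"
  shows "has_value_at_inf (to_fract p / to_fract q) (coeff p (degree q) / lead_coeff q)"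
  using assms unfolding has_value_at_inf_def by blast

lemma ratfun_var_minus_const: "ratfun_var - ratfun_const a = to_fract [:- a, 1:]"
  by (simp add: ratfun_var_def ratfun_const_def flip: to_fract_diff)

lemma has_value_at_inf_linear_quotient:
  "has_value_at_inf ((ratfun_var - ratfun_const a) / (ratfun_var - ratfun_const b)) 1"
  using has_value_at_inf_to_fract_divide[of "[:- b, 1:]" "[:- a, 1:]"]
  by (simp add: ratfun_var_minus_const)

lemma has_value_at_inf_inverse_linear:
  "has_value_at_inf (1 / (ratfun_var - ratfun_const a)) 0"
  using has_value_at_inf_to_fract_divide[of "[:- a, 1:]" 1]
  by (simp add: ratfun_var_minus_const)

lemma has_value_at_inf_power:
  "has_value_at_inf f v \<Longrightarrow> has_value_at_inf (f ^ k) (v ^ k)"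
  by (induction k) (auto intro: at_inf.R_1 at_inf.R_mult)

lemma has_value_at_inf_minus:
  assumes "has_value_at_inf f v" "has_value_at_inf g w"
  shows "has_value_at_inf (f - g) (v - w)"
  using at_inf.R_add[OF assms(1) at_inf.R_mult[OF at_inf.R_of_int[of "- 1"] assms(2)]] by simp

text \<open>Values at infinity pass through determinants, so normalization gives
  \<open>det g\<close> the value 1 there and hence \<open>det g\<close> is nonzero. Membership
  becomes an entrywise check.\<close>

lemma negative_loops_iff:
  fixes g :: "ratfun ^ 'n ^ 'n"
  shows "g \<in> negative_loops \<longleftrightarrow>
    (\<forall>i j. has_value_at_inf (g $ i $ j) ((mat 1 :: complex ^ 'n ^ 'n) $ i $ j))"
proof -
  have "det g \<noteq> 0"
    if "\<forall>i j. has_value_at_inf (g $ i $ j) ((mat 1 :: complex ^ 'n ^ 'n) $ i $ j)"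
  proof
    assume "det g = 0"
    then have "has_value_at_inf 0 1"
      using at_inf.R_det[of g "mat 1"] that by simp
    from at_inf.R_unique[OF at_inf.R_0 this] show False
      by simp
  qed
  then show ?thesis
    unfolding negative_loops_def by (auto simp: rational_loops_iff_det)
qed

section \<open>The generators are negative loops\<close>

lemma direct_sum_component_unique:
  assumes "is_direct_sum V W" "v \<in> V" "w \<in> W" "v' \<in> V" "w' \<in> W" "v + w = v' + w'"
  shows "v = v'"
proof -
  have "v - v' = w' - w"
    using assms(6) by (simp add: algebra_simps)
  moreover have "v - v' \<in> V" "w' - w \<in> W"
    using assms by (auto simp: is_direct_sum_def intro: vec.subspace_diff)
  ultimately have "v - v' \<in> V \<inter> W" by simp
  then have "v - v' \<in> {0}"
    using assms(1) unfolding is_direct_sum_def by metis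
  then show ?thesis by simp
qed

lemma is_direct_sum_commute: "is_direct_sum V W \<longleftrightarrow> is_direct_sum W V"
proof -
  have "{v + w |v w. v \<in> V \<and> w \<in> W} = {w + v |w v. w \<in> W \<and> v \<in> V}"
    by (auto simp: add.commute) (metis add.commute)+
  then show ?thesis
    by (auto simp: is_direct_sum_def Int_commute)
qed

text \<open>Column \<open>j\<close> of the matrix is the image of \<open>axis j 1\<close>. Any
  explicit splitting of that basis vector therefore resolves the \<open>THE\<close> in the
  definition.\<close>

lemma proj_along_nth:
  assumes "is_direct_sum V W" "v \<in> V" "w \<in> W" "axis j 1 = v + w"
  shows "proj_along V W $ i $ j = v $ i"
proof -
  have "(THE v. v \<in> V \<and> (\<exists>w\<in>W. axis j 1 = v + w)) = v"
    using assms direct_sum_component_unique[OF assms(1)] by (intro the_equality) metis+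
  then show ?thesis
    by (simp add: proj_along_def matrix_def)
qed

lemma proj_along_add: "is_direct_sum V W \<Longrightarrow> proj_along V W + proj_along W V = mat 1"
proof -
  assume VW: "is_direct_sum V W"
  have "proj_along V W $ i $ j + proj_along W V $ i $ j = mat 1 $ i $ j" for i j
  proof -
    have "axis j 1 \<in> {v + w |v w. v \<in> V \<and> w \<in> W}"
      using VW by (simp add: is_direct_sum_def)
    then obtain v w where vw: "v \<in> V" "w \<in> W" "axis j 1 = v + w" by blast
    have "proj_along V W $ i $ j = v $ i"
      using proj_along_nth[OF VW vw] .
    moreover have "proj_along W V $ i $ j = w $ i"
      using proj_along_nth[of W V w v j i] VW vw by (simp add: is_direct_sum_commute add.commute)
    ultimately have "proj_along V W $ i $ j + proj_along W V $ i $ j = axis j 1 $ i"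
      by (simp add: vw(3))
    then show ?thesis by (simp add: axis_def mat_def)
  qed
  then show ?thesis by (simp add: vec_eq_iff)
qed

lemma p_loops_subset: "(p_loops :: (ratfun ^ 'n ^ 'n) set) \<subseteq> negative_loops"
proof
  fix g :: "ratfun ^ 'n ^ 'n" assume "g \<in> p_loops"
  then obtain a b V W where g: "g = p_loop a b V W" and VW: "is_direct_sum V W"
    by (auto simp: p_loops_def)
  have "has_value_at_inf (g $ i $ j) ((mat 1 :: complex ^ 'n ^ 'n) $ i $ j)" for i j
  proof -
    have "has_value_at_inf (g $ i $ j) (1 * proj_along V W $ i $ j + proj_along W V $ i $ j)"
      unfolding g p_loop_def
      by (simp only: vec_lambda_beta)
        (intro at_inf.R_add at_inf.R_mult at_inf.R_const has_value_at_inf_linear_quotient)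
    also have "1 * proj_along V W $ i $ j + proj_along W V $ i $ j = mat 1 $ i $ j"
      by (simp flip: proj_along_add[OF VW])
    finally show ?thesis .
  qed
  then show "g \<in> negative_loops" by (simp add: negative_loops_iff)
qed

lemma m_loops_subset: "(m_loops :: (ratfun ^ 'n ^ 'n) set) \<subseteq> negative_loops"
proof
  fix g :: "ratfun ^ 'n ^ 'n" assume "g \<in> m_loops"
  then obtain a k N where g: "g = m_loop a k N" and k: "k > 0"
    by (auto simp: m_loops_def)
  have "has_value_at_inf (g $ i $ j) ((mat 1 :: complex ^ 'n ^ 'n) $ i $ j)" for i j
  proof -
    \<comment> \<open>\<open>0 ^ k\<close> is 0 only because \<open>k > 0\<close>; for
      \<open>k = 0\<close> the value would be the entry of \<open>mat 1 + N\<close>.\<close>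
    have "has_value_at_inf (g $ i $ j) (mat 1 $ i $ j + 0 ^ k * N $ i $ j)"
      unfolding g m_loop_def
      by (simp only: vec_lambda_beta vector_add_component)
        (intro at_inf.R_add at_inf.R_mult at_inf.R_const at_inf.R_mat_1 has_value_at_inf_power
          has_value_at_inf_inverse_linear)
    then show ?thesis using k by (simp add: zero_power)
  qed
  then show "g \<in> negative_loops" by (simp add: negative_loops_iff)
qed

section \<open>Matrices differing from the identity in one column\<close>

text \<open>One encoding covers both elementary types: \<open>(\<lambda>_. 0)(p := u)\<close> gives
  a diagonal matrix, \<open>(\<lambda>_. 0)(p := 1, i := x)\<close> with \<open>i \<noteq> p\<close>
  a transvection.\<close>

definition col_mat :: "'n \<Rightarrow> ('n \<Rightarrow> 'a) \<Rightarrow> 'a :: zero_neq_one ^ 'n ^ 'n" where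
  "col_mat p c = (\<chi> i j. if j = p then c i else if i = j then 1 else 0)"

lemma col_mat_nth [simp]:
  "col_mat p c $ i $ j = (if j = p then c i else if i = j then 1 else 0)"
  by (simp add: col_mat_def)

lemma col_mat_unit [simp]: "col_mat p ((\<lambda>_. 0)(p := 1)) = mat 1"
  by (auto simp: vec_eq_iff mat_def)

lemma col_mat_mult_nth:
  fixes g :: "'a :: comm_ring_1 ^ 'n ^ 'n"
  shows "(col_mat p c ** g) $ i $ j = c i * g $ p $ j + (if i = p then 0 else g $ i $ j)"
proof -
  have "(col_mat p c ** g) $ i $ j = (\<Sum>k\<in>UNIV. col_mat p c $ i $ k * g $ k $ j)"
    by (simp add: matrix_matrix_mult_def)
  \<comment> \<open>At most the terms \<open>k = p\<close> and \<open>k = i\<close> survive; for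
    \<open>i = p\<close> they coincide, so the second is set to 0.\<close>
  also have "\<dots> = (\<Sum>k\<in>UNIV. (if k = p then c i * g $ p $ j else 0)
      + (if k = i then if i = p then 0 else g $ i $ j else 0))"
    by (intro sum.cong) auto
  also have "\<dots> = c i * g $ p $ j + (if i = p then 0 else g $ i $ j)"
    by (simp add: sum.distrib)
  finally show ?thesis .
qed

lemma col_mat_diagonal_mult:
  fixes u v :: "'a :: comm_ring_1"
  shows "col_mat p ((\<lambda>_. 0)(p := u)) ** col_mat p ((\<lambda>_. 0)(p := v))
    = col_mat p ((\<lambda>_. 0)(p := u * v))"
  by (auto simp: vec_eq_iff col_mat_mult_nth)

text \<open>The right factor adds \<open>x\<close> times column \<open>i\<close> of the left factor
  to column \<open>p\<close>. As \<open>i \<noteq> p\<close>, that column is a unit vector, so a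
  single entry changes.\<close>

lemma col_mat_transvection_mult:
  fixes c :: "'n :: finite \<Rightarrow> 'a :: comm_ring_1"
  assumes "i \<noteq> p"
  shows "col_mat p c ** col_mat p ((\<lambda>_. 0)(p := 1, i := x)) = col_mat p (c(i := c i + x))"
  using assms by (auto simp: vec_eq_iff col_mat_mult_nth)

section \<open>Decomposition into generators\<close>

abbreviation generated_loops :: "(ratfun ^ 'n ^ 'n) set" where
  "generated_loops \<equiv> generate negative_loop_group (p_loops \<union> m_loops)"

lemma mat_1_generated: "mat 1 \<in> generated_loops"
  using generate.one[of negative_loop_group]
  by (simp add: negative_loop_group_def rational_loop_group_def)

lemma mult_generated: "g \<in> generated_loops \<Longrightarrow> h \<in> generated_loops \<Longrightarrow> g ** h \<in> generated_loops"
  using generate.eng[of g negative_loop_group _ h]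
  by (simp add: negative_loop_group_def rational_loop_group_def)

section \<open>Diagonal factors from loops of the first kind\<close>

text \<open>For distinct \<open>a\<close> and \<open>b\<close> this is \<open>p_loop a b V W\<close>
  with \<open>V\<close> the \<open>p\<close>-th coordinate line and \<open>W\<close> the
  complementary coordinate hyperplane. The case \<open>a = b\<close> gives the identity; it occurs
  when numerator and denominator share a root.\<close>

lemma col_mat_linear_quotient_generated:
  fixes p :: "'n :: finite"
  shows "col_mat p ((\<lambda>_. 0)(p := (ratfun_var - ratfun_const a) / (ratfun_var - ratfun_const b)))
    \<in> generated_loops"
proof (cases "a = b")
  case True
  have "ratfun_var - ratfun_const b \<noteq> 0"
    by (simp add: ratfun_var_minus_const)
  with True show ?thesis by (simp add: mat_1_generated)
next
  case False
  define V :: "(complex ^ 'n) set" where "V = {x. \<forall>i. i \<noteq> p \<longrightarrow> x $ i = 0}"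
  define W :: "(complex ^ 'n) set" where "W = {x. x $ p = 0}"
  have "x \<in> {v + w |v w. v \<in> V \<and> w \<in> W}" for x
  proof -
    have "x = axis p (x $ p) + (x - axis p (x $ p))" by simp
    moreover have "axis p (x $ p) \<in> V" "x - axis p (x $ p) \<in> W"
      by (auto simp: V_def W_def axis_def)
    ultimately show ?thesis by blast
  qed
  moreover have "V \<inter> W = {0}"
    by (auto simp: V_def W_def vec_eq_iff)
  moreover have "vec.subspace V" "vec.subspace W"
    by (auto simp: V_def W_def vec.subspace_def)
  ultimately have VW: "is_direct_sum V W"
    unfolding is_direct_sum_def by blast
  have V_nth: "proj_along V W $ i $ j = (if i = p \<and> j = p then 1 else 0)" for i j
    using proj_along_nth[OF VW, of "if j = p then axis j 1 else 0" "if j = p then 0 else axis j 1" j i]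
    by (auto simp: V_def W_def axis_def)
  have W_nth: "proj_along W V $ i $ j = (if i = j \<and> j \<noteq> p then 1 else 0)" for i j
    using arg_cong[OF proj_along_add[OF VW], of "\<lambda>A. A $ i $ j"] V_nth[of i j]
    by (auto simp: mat_def split: if_splits)
  have c: "ratfun_const 1 = 1" "ratfun_const 0 = 0"
    by (simp_all add: ratfun_const_def flip: one_pCons)
  have "col_mat p ((\<lambda>_. 0)(p := (ratfun_var - ratfun_const a) / (ratfun_var - ratfun_const b)))
      = p_loop a b V W"
    by (auto simp: vec_eq_iff p_loop_def V_nth W_nth c)
  moreover have "p_loop a b V W \<in> p_loops"
    using False VW by (auto simp: p_loops_def)
  ultimately show ?thesis
    by (simp add: generate.incl)
qed

lemma linear_factor:
  fixes p :: "complex poly"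
  assumes "degree p > 0"
  obtains a q where "p = [:- a, 1:] * q" "degree p = Suc (degree q)" "lead_coeff q = lead_coeff p"
proof -
  have "\<not> constant (poly p)"
    using assms by (simp add: constant_degree)
  then obtain a where "poly p a = 0"
    using fundamental_theorem_of_algebra by blast
  then obtain q where q: "p = [:- a, 1:] * q"
    by (auto simp: poly_eq_0_iff_dvd)
  then have "q \<noteq> 0" using assms by auto
  then have "degree p = Suc (degree q)"
    unfolding q by (subst degree_mult_eq) auto
  moreover have "lead_coeff p = lead_coeff q"
    unfolding q lead_coeff_mult by simp
  ultimately show ?thesis
    using that q by simp
qed

text \<open>Each induction step splits one monic linear factor off both numerator and denominator,
  which preserves equality of degrees and of leading coefficients. In degree 0 the two constants
  agree.\<close>

lemma col_mat_diagonal_poly_generated: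
  assumes "degree q = degree r" "lead_coeff q = lead_coeff r" "r \<noteq> 0"
  shows "col_mat p ((\<lambda>_. 0)(p := to_fract q / to_fract r)) \<in> generated_loops"
  using assms
proof (induction "degree q" arbitrary: q r)
  case 0
  then have "q = r"
    by (metis degree_0_id)
  then have "to_fract q / to_fract r = 1"
    using 0 by simp
  then show ?case
    by (simp only: col_mat_unit mat_1_generated)
next
  case (Suc d)
  obtain a q' where q': "q = [:- a, 1:] * q'" "degree q = Suc (degree q')" "lead_coeff q' = lead_coeff q"
    using linear_factor[of q] Suc.hyps by auto
  obtain b r' where r': "r = [:- b, 1:] * r'" "degree r = Suc (degree r')" "lead_coeff r' = lead_coeff r"
    using linear_factor[of r] Suc.hyps Suc.prems by auto
  have "col_mat p ((\<lambda>_. 0)(p := to_fract q' / to_fract r')) \<in> generated_loops"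
    using Suc q' r' by (intro Suc.hyps) auto
  then have "col_mat p ((\<lambda>_. 0)(p := (ratfun_var - ratfun_const a) / (ratfun_var - ratfun_const b)
      * (to_fract q' / to_fract r'))) \<in> generated_loops"
    using mult_generated[OF col_mat_linear_quotient_generated, of _ p a b]
    by (metis col_mat_diagonal_mult)
  then show ?case
    by (simp only: q' r' ratfun_var_minus_const to_fract_mult times_divide_times_eq)
qed

lemma col_mat_diagonal_generated:
  assumes "has_value_at_inf u 1"
  shows "col_mat p ((\<lambda>_. 0)(p := u)) \<in> generated_loops"
proof -
  obtain q r where u: "u = to_fract q / to_fract r" "r \<noteq> 0" "degree q \<le> degree r"
      "1 = coeff q (degree r) / lead_coeff r"
    using assms unfolding has_value_at_inf_def by blast
  then have c: "coeff q (degree r) = lead_coeff r" by (simp add: field_simps)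
  \<comment> \<open>The coefficient of \<open>q\<close> in degree \<open>degree r\<close> is
    nonzero, so the degree of \<open>q\<close> cannot drop.\<close>
  then have "degree q = degree r"
    using u by (metis le_antisym le_degree leading_coeff_0_iff)
  then show ?thesis
    using c u col_mat_diagonal_poly_generated by metis
qed

section \<open>Transvections from loops of the second kind\<close>

lemma col_mat_pole_generated:
  fixes i p :: "'n :: finite"
  assumes "i \<noteq> p" "k > 0"
  shows "col_mat p ((\<lambda>_. 0)(p := 1, i := (1 / (ratfun_var - ratfun_const a)) ^ k * ratfun_const c))
    \<in> generated_loops"
proof -
  define N :: "complex ^ 'n ^ 'n" where "N = (\<chi> r s. if r = i \<and> s = p then c else 0)"
  have "N ** N = 0"
    using assms(1) by (auto simp: matrix_matrix_mult_def vec_eq_iff N_def intro!: sum.neutral)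
  then have "m_loop a k N \<in> m_loops"
    using assms(2) by (auto simp: m_loops_def)
  moreover have "ratfun_const 0 = 0"
    by (simp add: ratfun_const_def)
  then have "col_mat p ((\<lambda>_. 0)(p := 1, i := (1 / (ratfun_var - ratfun_const a)) ^ k * ratfun_const c))
      = m_loop a k N"
    using assms(1) by (auto simp: vec_eq_iff m_loop_def N_def mat_def)
  ultimately show ?thesis
    by (simp add: generate.incl)
qed

text \<open>Partial fractions, one term at a time: the top-order pole part at a root
  \<open>a\<close> of \<open>r\<close> is split off, which lowers the degree of the denominator by
  one. Sums of entries correspond to products of transvections.\<close>

lemma col_mat_transvection_poly_generated:
  assumes "i \<noteq> p" "degree q < degree r"
  shows "col_mat p ((\<lambda>_. 0)(p := 1, i := to_fract q / to_fract r)) \<in> generated_loops"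
  using assms(2)
proof (induction "degree r" arbitrary: q r rule: less_induct)
  case less
  have "\<not> constant (poly r)"
    using less.prems by (simp add: constant_degree)
  then obtain a where a: "poly r a = 0"
    using fundamental_theorem_of_algebra by blast
  have r0: "r \<noteq> 0" using less.prems by auto
  obtain s where s: "r = [:- a, 1:] ^ Polynomial.order a r * s" "\<not> [:- a, 1:] dvd s"
    using order_decomp[OF r0, of a] by blast
  obtain m where m: "Polynomial.order a r = Suc m"
    using a r0 order_root[of r a] by (metis not0_implies_Suc)
  have sa: "poly s a \<noteq> 0" and s0: "s \<noteq> 0"
    using s(2) by (auto simp: poly_eq_0_iff_dvd)
  define l where "l = [:- a, 1:]"
  have l0: "l \<noteq> 0" and dl: "degree l = 1" by (simp_all add: l_def)
  have r: "r = l ^ Suc m * s" using s(1) m by (simp add: l_def)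
  have dr: "degree r = Suc m + degree s"
    unfolding r using l0 s0 dl by (simp add: degree_mult_eq degree_power_eq del: power_Suc)
  \<comment> \<open>The leading polar coefficient at \<open>a\<close>: it makes
    \<open>q - smult c s\<close> vanish at \<open>a\<close>, so that one factor \<open>l\<close>
    cancels.\<close>
  define c where "c = poly q a / poly s a"
  have "poly (q - smult c s) a = 0"
    using sa by (simp add: c_def)
  then obtain q' where q': "q - smult c s = l * q'"
    unfolding poly_eq_0_iff_dvd l_def by (elim dvdE)
  define r' where "r' = l ^ m * s"
  have dr': "degree r = Suc (degree r')"
    using dr l0 s0 dl by (simp add: r'_def degree_mult_eq degree_power_eq)
  have "q = [:c:] * s + l * q'"
    using q' by (simp add: algebra_simps)
  then have "to_fract q = ratfun_const c * to_fract s + to_fract l * to_fract q'"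
    by (simp only: ratfun_const_def to_fract_add to_fract_mult)
  moreover have "to_fract (l ^ m) = to_fract l ^ m"
    by (induction m) auto
  ultimately have q_r: "to_fract q / to_fract r
      = to_fract q' / to_fract r' + (1 / (ratfun_var - ratfun_const a)) ^ Suc m * ratfun_const c"
    using l0 s0 unfolding ratfun_var_minus_const r r'_def
    by (simp add: field_simps flip: l_def)
  have "col_mat p ((\<lambda>_. 0)(p := 1, i := to_fract q' / to_fract r')) \<in> generated_loops"
  \<comment> \<open>Here the recursion ends: when \<open>r'\<close> is constant, \<open>q'\<close>
    is 0, and its degree 0 is not below \<open>degree r'\<close>.\<close>
  proof (cases "q' = 0")
    case True
    then show ?thesis
      using assms(1) by (simp add: mat_1_generated fun_upd_idem)
  next
    case False
    have "degree (l * q') < degree r"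
      unfolding q'[symmetric] using less.prems dr degree_smult_le[of c s]
      by (intro degree_diff_less) auto
    then have "degree q' < degree r'"
      using False l0 dl dr' by (simp add: degree_mult_eq)
    then show ?thesis
      using dr' by (intro less.hyps) auto
  qed
  then have "col_mat p ((\<lambda>_. 0)(p := 1, i := to_fract q' / to_fract r'))
      ** col_mat p ((\<lambda>_. 0)(p := 1, i := (1 / (ratfun_var - ratfun_const a)) ^ Suc m * ratfun_const c))
      \<in> generated_loops"
    using assms(1) by (intro mult_generated col_mat_pole_generated) auto
  then show ?case
    unfolding q_r col_mat_transvection_mult[OF assms(1)] by simp
qed

lemma col_mat_transvection_generated:
  assumes "i \<noteq> p" "has_value_at_inf f 0"
  shows "col_mat p ((\<lambda>_. 0)(p := 1, i := f)) \<in> generated_loops"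
proof -
  obtain q r where f: "f = to_fract q / to_fract r" "r \<noteq> 0" "degree q \<le> degree r"
      "0 = coeff q (degree r) / lead_coeff r"
    using assms(2) unfolding has_value_at_inf_def by blast
  then have c: "coeff q (degree r) = 0" by simp
  show ?thesis
  \<comment> \<open>For constant \<open>r\<close> the zero numerator has the same degree as
    \<open>r\<close>, so the strict degree bound is available only for nonzero
    \<open>q\<close>.\<close>
  proof (cases "q = 0")
    case True
    then show ?thesis
      using assms(1) f by (simp add: mat_1_generated fun_upd_idem)
  next
    case False
    then have "degree q \<noteq> degree r"
      using c leading_coeff_0_iff by metis
    then show ?thesis
      using f assms(1) by (simp add: col_mat_transvection_poly_generated)
  qed
qed

section \<open>Gauss-Jordan elimination by columns\<close>

text \<open>The diagonal factor comes first and transvections are multiplied on the right, one for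
  each remaining entry. In this order the transvection entries are the \<open>c i\<close>
  themselves, without division by \<open>c p\<close>.\<close>

lemma col_mat_generated:
  fixes c :: "'n :: finite \<Rightarrow> ratfun"
  assumes "has_value_at_inf (c p) 1" "\<And>i. i \<noteq> p \<Longrightarrow> has_value_at_inf (c i) 0"
  shows "col_mat p c \<in> generated_loops"
proof -
  have "col_mat p (\<lambda>i. if i \<in> insert p S then c i else 0) \<in> generated_loops" for S
    using finite[of S]
  proof (induction S rule: finite_induct)
    case empty
    have "(\<lambda>i. if i \<in> {p} then c i else 0) = (\<lambda>_. 0)(p := c p)" by auto
    then show ?case
      using col_mat_diagonal_generated[OF assms(1)] by simp
  next
    case (insert j S)
    show ?case
    proof (cases "j = p")
      case True
      then show ?thesis using insert.IH by simp
    next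
      case False
      let ?d = "\<lambda>i. if i \<in> insert p S then c i else 0"
      have "?d(j := ?d j + c j) = (\<lambda>i. if i \<in> insert p (insert j S) then c i else 0)"
        using False insert.hyps by auto
      then show ?thesis
        using mult_generated[OF insert.IH col_mat_transvection_generated[OF False assms(2)[OF False]]]
        unfolding col_mat_transvection_mult[OF False] by simp
    qed
  qed
  from this[of UNIV] show ?thesis by simp
qed

text \<open>\<open>S\<close> holds the columns that may still differ from those of the identity.
  Each step splits off column \<open>p\<close> as a left factor and leaves a negative loop with
  \<open>p\<close> removed from \<open>S\<close>.\<close>

lemma negative_loop_generated:
  fixes g :: "ratfun ^ 'n ^ 'n"
  assumes "g \<in> negative_loops" "\<And>i j. j \<notin> S \<Longrightarrow> g $ i $ j = mat 1 $ i $ j"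
  shows "g \<in> generated_loops"
  using finite[of S] assms
proof (induction S arbitrary: g rule: finite_induct)
  case empty
  then have "g = mat 1" by (simp add: vec_eq_iff)
  then show ?case by (simp add: mat_1_generated)
next
  case (insert p S)
  have val: "has_value_at_inf (g $ i $ j) (if i = j then 1 else 0)" for i j
    using insert.prems(1) by (simp add: negative_loops_iff mat_def)
  define c where "c = (\<lambda>i. g $ i $ p)"
  have cp: "has_value_at_inf (c p) 1" and ci: "\<And>i. i \<noteq> p \<Longrightarrow> has_value_at_inf (c i) 0"
    using val by (metis c_def)+
  have nz: "c p \<noteq> 0"
    using cp at_inf.R_0 at_inf.R_unique by fastforce
  have inv: "has_value_at_inf (inverse (c p)) 1"
    using at_inf.R_inverse[OF cp] by simp
  \<comment> \<open>This is the inverse of \<open>col_mat p c\<close> times \<open>g\<close>: row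
    \<open>p\<close> is divided by the pivot, then used to clear column \<open>p\<close> in the
    other rows.\<close>
  define h :: "ratfun ^ 'n ^ 'n" where
    "h = (\<chi> i j. if i = p then g $ p $ j * inverse (c p)
                else g $ i $ j - c i * (g $ p $ j * inverse (c p)))"
  have g: "g = col_mat p c ** h"
    using nz by (simp add: vec_eq_iff col_mat_mult_nth h_def)
  have pj: "has_value_at_inf (g $ p $ j * inverse (c p)) (if p = j then 1 else 0)" for j
    using at_inf.R_mult[OF val[of p j] inv] by simp
  have "has_value_at_inf (h $ i $ j) (if i = j then 1 else 0)" for i j
  proof (cases "i = p")
    case True
    then show ?thesis using pj[of j] by (simp add: h_def)
  next
    case False
    then show ?thesis
      \<comment> \<open>The correction has value 0 at infinity because \<open>c i\<close> does, so
        \<open>h\<close> stays normalized and its next pivot is again a unit there.\<close>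
      using has_value_at_inf_minus[OF val[of i j] at_inf.R_mult[OF ci[OF False] pj[of j]]]
      by (simp only: h_def vec_lambda_beta if_False mult_zero_left diff_zero)
  qed
  then have "h \<in> negative_loops"
    by (simp add: negative_loops_iff mat_def)
  moreover have "h $ i $ j = mat 1 $ i $ j" if "j \<notin> S" for i j
  proof (cases "j = p")
    case True
    then show ?thesis
      using nz by (auto simp: h_def mat_def c_def)
  next
    case False
    \<comment> \<open>An already cleared column has entry 0 in row \<open>p\<close>, so the row
      operations leave it alone.\<close>
    then have "g $ k $ j = mat 1 $ k $ j" for k
      using insert.prems(2) that by simp
    then show ?thesis
      using False by (auto simp: h_def mat_def)
  qed
  ultimately have "h \<in> generated_loops"
    by (rule insert.IH)
  moreover have "col_mat p c \<in> generated_loops"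
    using cp ci by (rule col_mat_generated)
  ultimately show ?case
    unfolding g by (intro mult_generated)
qed

theorem theorem3p1:
  shows "generate negative_loop_group (p_loops \<union> m_loops)
           = carrier (negative_loop_group :: (ratfun ^ 'n ^ 'n) monoid)"
proof
  have "p_loops \<union> m_loops \<subseteq> carrier (negative_loop_group :: (ratfun ^ 'n ^ 'n) monoid)"
    using p_loops_subset m_loops_subset by (simp add: negative_loop_group_def)
  then show "generate negative_loop_group (p_loops \<union> m_loops)
      \<subseteq> carrier (negative_loop_group :: (ratfun ^ 'n ^ 'n) monoid)"
    using group.generate_incl[OF group_negative_loop_group] by blast
next
  show "carrier (negative_loop_group :: (ratfun ^ 'n ^ 'n) monoid)
      \<subseteq> generate negative_loop_group (p_loops \<union> m_loops)"
    using negative_loop_generated[of _ UNIV] by (auto simp: negative_loop_group_def)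
qed

end
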